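(* For every integer $w\ge 0$, let $N(w)$ be the largest number of coins $N$ for which there exists a $(w,N)$-algorithm for the FC-problem. Then $$N(w)\le \left\lfloor \sqrt{2\cdot 3^w+\tfrac14}+\tfrac12\right\rfloor .$$
   Context: FC-problem: there are $N\ge 2$ coins, identical in appearance. Exactly one is fake, exactly one (a different one) is a chameleon, and the remaining $N-2$ are real. All real coins have equal weight; the fake coin is lighter than a real coin. In each weighing the chameleon weighs either as much as a real coin or as much as the fake coin, the choice being made arbitrarily (adversarially) and independently for each weighing. A weighing places two disjoint sets of coins, with equal numbers of coins, on the two pans of a balance; the outcome is "balance", "first pan lighter" or "second pan lighter". Weighings are adaptive: each may depend on the outcomes of previous ones. The task is to output at most two coins such that the fake coin is guaranteed to be among them, whatever the positions of the fake and the chameleon and whatever the chameleon's behavior. A $(w,N)$-algorithm (also called $(w,N)$-solution) is an adaptive strategy that accomplishes this for $N$ coins using at most $w$ weighings. *)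

theory Defs
  imports Complex_Main
begin

text \<open>
  The coins are \<open>{..<N}\<close>.  The numbers \<open>r\<close> and \<open>l\<close> are the weights of a real and of the fake
  coin, \<open>f\<close> is the fake coin, \<open>c\<close> the chameleon, and \<open>b\<close> tells whether the chameleon
  weighs as much as the fake coin in the weighing at hand.
\<close>

definition coin_weight :: "real \<Rightarrow> real \<Rightarrow> nat \<Rightarrow> nat \<Rightarrow> bool \<Rightarrow> nat \<Rightarrow> real" where
  "coin_weight r l f c b x = (if x = f \<or> x = c \<and> b then l else r)"

datatype outcome = Balance | First_Lighter | Second_Lighter

definition weigh :: "(nat \<Rightarrow> real) \<Rightarrow> nat set \<Rightarrow> nat set \<Rightarrow> outcome" where
  "weigh wt A B =
    (if sum wt A < sum wt B then First_Lighter
     else if sum wt B < sum wt A then Second_Lighter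
     else Balance)"

text \<open>An adaptive strategy is a decision tree.\<close>

datatype strategy =
    Answer "nat set"
  | Weigh "nat set" "nat set" "outcome \<Rightarrow> strategy"

primrec legal :: "nat \<Rightarrow> strategy \<Rightarrow> bool" where
  "legal N (Answer S) \<longleftrightarrow> S \<subseteq> {..<N} \<and> card S \<le> 2"
| "legal N (Weigh A B k) \<longleftrightarrow>
     A \<subseteq> {..<N} \<and> B \<subseteq> {..<N} \<and> A \<inter> B = {} \<and> card A = card B \<and> (\<forall>out. legal N (k out))"

text \<open>The number of weighings in the worst case.\<close>

primrec weighings :: "strategy \<Rightarrow> nat" where
  "weighings (Answer S) = 0"
| "weighings (Weigh A B k) =
     Suc (max (weighings (k Balance))
           (max (weighings (k First_Lighter)) (weighings (k Second_Lighter))))"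

text \<open>
  The behaviour of the chameleon is a sequence \<open>bs\<close> with one entry per weighing.  Since strategies
  are deterministic, a chameleon that reacts to the weighings made so far achieves no more than
  an arbitrary sequence fixed in advance.
\<close>

primrec run :: "strategy \<Rightarrow> real \<Rightarrow> real \<Rightarrow> nat \<Rightarrow> nat \<Rightarrow> (nat \<Rightarrow> bool) \<Rightarrow> nat set" where
  "run (Answer S) r l f c bs = S"
| "run (Weigh A B k) r l f c bs =
     run (k (weigh (coin_weight r l f c (bs 0)) A B)) r l f c (\<lambda>i. bs (Suc i))"

definition FC_algorithm :: "nat \<Rightarrow> nat \<Rightarrow> strategy \<Rightarrow> bool" where
  "FC_algorithm w N s \<longleftrightarrow>
     legal N s \<and> weighings s \<le> w \<and>
     (\<forall>r l f c bs. 0 < l \<and> l < r \<and> f < N \<and> c < N \<and> f \<noteq> c \<longrightarrow> f \<in> run s r l f c bs)"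

definition FC_sizes :: "nat \<Rightarrow> nat set" where
  "FC_sizes w = {N. 2 \<le> N \<and> (\<exists>s. FC_algorithm w N s)}"

definition FC_max :: "nat \<Rightarrow> nat" where
  "FC_max w = Max (FC_sizes w)"

text \<open>The maximum is taken over a nonempty finite set: two coins need no weighing, and a tree with
  at most \<open>3 ^ w\<close> leaves names at most \<open>2 * 3 ^ w\<close> coins.\<close>

lemma two_in_FC_sizes: "2 \<in> FC_sizes w"
proof -
  have "FC_algorithm w 2 (Answer {..<2})"
    by (auto simp: FC_algorithm_def)
  then show ?thesis
    by (auto simp: FC_sizes_def)
qed

primrec named_coins :: "strategy \<Rightarrow> nat set" where
  "named_coins (Answer S) = S"
| "named_coins (Weigh A B k) =
     named_coins (k Balance) \<union> named_coins (k First_Lighter) \<union> named_coins (k Second_Lighter)"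

lemma run_subset_named_coins: "run s r l f c bs \<subseteq> named_coins s"
proof (induction s arbitrary: bs)
  case (Weigh A B k)
  define out where "out = weigh (coin_weight r l f c (bs 0)) A B"
  have "run (k out) r l f c (\<lambda>i. bs (Suc i)) \<subseteq> named_coins (k out)"
    using Weigh by blast
  then show ?case
    by (cases out) (auto simp: out_def)
qed simp

lemma card_named_coins: "legal N s \<Longrightarrow> weighings s \<le> w \<Longrightarrow> card (named_coins s) \<le> 2 * 3 ^ w"
proof (induction s arbitrary: w)
  case (Answer S)
  then have "card S \<le> 2 * 1" by simp
  also have "\<dots> \<le> 2 * (3::nat) ^ w" by (intro mult_left_mono) simp_all
  finally show ?case by simp
next
  case (Weigh A B k)
  then obtain w' where w: "w = Suc w'"
    by (cases w) auto
  have "card (named_coins (k out)) \<le> 2 * 3 ^ w'" for out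
  proof (rule Weigh.IH)
    show "legal N (k out)" using Weigh.prems by simp
    show "weighings (k out) \<le> w'" using Weigh.prems w by (cases out) simp_all
  qed simp
  from this[of Balance] this[of First_Lighter] this[of Second_Lighter]
  show ?case
    using card_Un_le[of "named_coins (k Balance)" "named_coins (k First_Lighter)"]
      card_Un_le[of "named_coins (k Balance) \<union> named_coins (k First_Lighter)"
        "named_coins (k Second_Lighter)"] w
    by simp
qed

lemma finite_named_coins: "legal N s \<Longrightarrow> finite (named_coins s)"
  by (induction s) (auto intro: finite_subset[of _ "{..<N}"])

lemma finite_FC_sizes: "finite (FC_sizes w)"
proof (rule finite_subset)
  show "FC_sizes w \<subseteq> {..2 * 3 ^ w}"
  proof
    fix N assume "N \<in> FC_sizes w"
    then obtain s where N: "2 \<le> N" and s: "FC_algorithm w N s"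
      by (auto simp: FC_sizes_def)
    have "{..<N} \<subseteq> named_coins s"
    proof
      fix f assume "f \<in> {..<N}"
      then have "f < N" by simp
      moreover obtain c where "c < N" "f \<noteq> c"
      proof
        show "(if f = 0 then 1 else 0) < N" "f \<noteq> (if f = 0 then 1 else 0)"
          using N by auto
      qed
      moreover have "(0::real) < 1" "(1::real) < 2" by simp_all
      ultimately have "f \<in> run s 2 1 f c (\<lambda>_. False)"
        using s unfolding FC_algorithm_def by blast
      then show "f \<in> named_coins s"
        using run_subset_named_coins by blast
    qed
    then have "card {..<N} \<le> card (named_coins s)"
      using s finite_named_coins by (intro card_mono) (auto simp: FC_algorithm_def)
    also have "\<dots> \<le> 2 * 3 ^ w"
      using s by (intro card_named_coins[of N]) (auto simp: FC_algorithm_def)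
    finally show "N \<in> {..2 * 3 ^ w}" by simp
  qed
qed simp

end

theory Submission
  imports Defs
begin

text \<open>
  A chameleon that always weighs as much as the fake coin cannot be told apart from it.  Hence, for
  any two coins, the strategy gives the same answer whichever of the two is fake, and this answer
  consists of exactly these two coins.  So all \<open>N choose 2\<close> pairs occur at the leaves of a ternary
  tree of depth at most \<open>w\<close>.
\<close>

primrec answers :: "strategy \<Rightarrow> nat set set" where
  "answers (Answer S) = {S}"
| "answers (Weigh A B k) =
     answers (k Balance) \<union> answers (k First_Lighter) \<union> answers (k Second_Lighter)"

lemma finite_answers: "finite (answers s)"
  by (induction s) auto

text \<open>A weighing has three outcomes, and each leads to a subtree with at least one weighing
  fewer, so the bound triples per level.\<close>

lemma card_answers: "weighings s \<le> w \<Longrightarrow> card (answers s) \<le> 3 ^ w"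
proof (induction s arbitrary: w)
  case (Weigh A B k)
  then obtain w' where w: "w = Suc w'"
    by (cases w) auto
  have "card (answers (k out)) \<le> 3 ^ w'" for out
    using Weigh.prems w by (intro Weigh.IH; cases out) simp_all
  from this[of Balance] this[of First_Lighter] this[of Second_Lighter]
  show ?case
    using card_Un_le[of "answers (k Balance)" "answers (k First_Lighter)"]
      card_Un_le[of "answers (k Balance) \<union> answers (k First_Lighter)" "answers (k Second_Lighter)"] w
    by simp
qed simp

lemma run_in_answers: "run s r l f c bs \<in> answers s"
proof (induction s arbitrary: bs)
  case (Weigh A B k)
  then show ?case
    by (cases "weigh (coin_weight r l f c (bs 0)) A B") auto
qed simp

lemma legal_run: "legal N s \<Longrightarrow> run s r l f c bs \<subseteq> {..<N} \<and> card (run s r l f c bs) \<le> 2"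
  by (induction s arbitrary: bs) auto

lemma coin_weight_swap: "coin_weight r l f c True = coin_weight r l c f True"
  by (auto simp: coin_weight_def fun_eq_iff)

text \<open>Both situations give every coin the same weight in every weighing, so they follow the
  same path down the tree. The constant sequence is unchanged by the shift in \<open>run\<close>, so
  the induction can keep it fixed.\<close>

lemma run_swap: "run s r l f c (\<lambda>_. True) = run s r l c f (\<lambda>_. True)"
  by (induction s) (auto simp: coin_weight_swap[of r l f c])

lemma pair_in_answers:
  assumes "FC_algorithm w N s" "a < N" "b < N" "a \<noteq> b"
  shows "{a, b} \<in> answers s"
proof -
  \<comment> \<open>Any weights with \<open>0 < l < r\<close> would do.\<close>
  define S where "S = run s 2 1 a b (\<lambda>_. True)"
  have "a \<in> S" "b \<in> run s 2 1 b a (\<lambda>_. True)"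
    using assms by (auto simp: FC_algorithm_def S_def)
  then have "{a, b} \<subseteq> S"
    by (simp add: S_def run_swap[of s 2 1 b a])
  moreover have "S \<subseteq> {..<N}" "card S \<le> 2"
    using assms(1) legal_run unfolding FC_algorithm_def S_def by blast+
  moreover have "finite S"
    using \<open>S \<subseteq> {..<N}\<close> finite_subset by blast
  \<comment> \<open>\<open>S\<close> has at most two elements and contains two distinct
    ones.\<close>
  ultimately have "{a, b} = S"
    using \<open>a \<noteq> b\<close> by (intro card_seteq) auto
  then show ?thesis
    by (simp add: S_def run_in_answers)
qed

lemma FC_algorithm_choose_le:
  assumes "FC_algorithm w N s"
  shows "N choose 2 \<le> 3 ^ w"
proof -
  have "N choose 2 = card {P. P \<subseteq> {..<N} \<and> card P = 2}"
    by (simp add: n_subsets)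
  also have "\<dots> \<le> card (answers s)"
    using pair_in_answers[OF assms] by (intro card_mono finite_answers) (auto simp: card_2_iff)
  also have "\<dots> \<le> 3 ^ w"
    using assms by (intro card_answers) (simp add: FC_algorithm_def)
  finally show ?thesis .
qed

theorem theorem2:
  fixes w :: nat
  shows "int (FC_max w) \<le> \<lfloor>sqrt (2 * 3 ^ w + 1 / 4) + 1 / 2\<rfloor>"
proof -
  define N where "N = FC_max w"
  have "N \<in> FC_sizes w"
    unfolding N_def FC_max_def using finite_FC_sizes two_in_FC_sizes by (intro Max_in) auto
  then have "2 \<le> N" and "N choose 2 \<le> 3 ^ w"
    by (auto simp: FC_sizes_def FC_algorithm_choose_le)
  \<comment> \<open>\<open>choose_two\<close> divides by 2 in the naturals; the division is exact
    because one of two consecutive numbers is even.\<close>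
  moreover have "N * (N - 1) = 2 * (N choose 2)"
    unfolding choose_two by (rule dvd_mult_div_cancel[symmetric]) auto
  ultimately have "N * (N - 1) \<le> 2 * 3 ^ w"
    by simp
  then have "real (N * (N - 1)) \<le> real (2 * 3 ^ w)"
    by (simp only: of_nat_le_iff)
  \<comment> \<open>Completing the square: the left side is \<open>N * (N - 1) + 1 / 4\<close>. By
    \<open>2 \<le> N\<close> the subtraction in \<open>N - 1\<close> is not truncated.\<close>
  then have "(real N - 1 / 2)\<^sup>2 \<le> 2 * 3 ^ w + 1 / 4"
    using \<open>2 \<le> N\<close> by (simp add: of_nat_diff power2_eq_square algebra_simps)
  then have "real N - 1 / 2 \<le> sqrt (2 * 3 ^ w + 1 / 4)"
    by (rule real_le_rsqrt)
  then show ?thesis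
    by (simp add: le_floor_iff N_def)
qed

end
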